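(* For every constant $k$, there is an algorithm that solves $\mathrm{NonExp}_{1}(\varepsilon,k)$ in time $O(\log^{\lceil k/2\rceil}(1/\varepsilon))$.
   Context: Let $\|\cdot\|_1$ be the $\ell_1$-norm on $\mathbb{R}^k$. A map $f:[0,1]^k\to[0,1]^k$ is nonexpansive with respect to $\|\cdot\|_1$ if $\|f(x)-f(y)\|_1\le\|x-y\|_1$ for all $x,y\in[0,1]^k$. In the problem $\mathrm{NonExp}_{1}(\varepsilon,k)$ (with $\varepsilon\in(0,1]$), an algorithm is given $\varepsilon$ and $k$ and black-box oracle access to an unknown nonexpansive map $f:[0,1]^k\to[0,1]^k$ with respect to $\|\cdot\|_1$: in each round it may send a point $x\in[0,1]^k$ to the oracle and receive $f(x)$. The goal is to output an $\varepsilon$-fixed point, i.e. a point $x\in[0,1]^k$ with $\|f(x)-x\|_1\le\varepsilon$. Running time counts total computation, with each oracle query costing one time step; the bound is worst case over all such $f$. *)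

theory Defs
  imports
    Complex_Main
    "HOL-Library.FuncSet"
    "HOL-Library.Landau_Symbols"
    "Jordan_Normal_Form.Matrix"
begin

definition l1_norm :: "real vec \<Rightarrow> real" where
  "l1_norm x = (\<Sum>i<dim_vec x. \<bar>x $ i\<bar>)"

definition unit_cube :: "nat \<Rightarrow> real vec set" where
  "unit_cube k = {x \<in> carrier_vec k. \<forall>i<k. 0 \<le> x $ i \<and> x $ i \<le> 1}"

definition nonexpansive_l1 :: "nat \<Rightarrow> (real vec \<Rightarrow> real vec) \<Rightarrow> bool" where
  "nonexpansive_l1 k f \<longleftrightarrow>
     f \<in> unit_cube k \<rightarrow> unit_cube k \<and>
     (\<forall>x\<in>unit_cube k. \<forall>y\<in>unit_cube k. l1_norm (f x - f y) \<le> l1_norm (x - y))"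

definition eps_fixed_point :: "nat \<Rightarrow> (real vec \<Rightarrow> real vec) \<Rightarrow> real \<Rightarrow> real vec \<Rightarrow> bool" where
  "eps_fixed_point k f \<epsilon> x \<longleftrightarrow> x \<in> unit_cube k \<and> l1_norm (f x - x) \<le> \<epsilon>"

text \<open>
  Algorithms are programs of a real RAM with unit-cost exact arithmetic.  There are two memories,
  one of natural numbers and one of reals, both indirectly addressable.  The available
  operations on reals are the field operations (with \<open>x / 0 = 0\<close>), rational constants and comparison; there is no
  rounding operation and no conversion between the two memories.  A program is a finite object
  that does not depend on \<open>\<epsilon>\<close>.
\<close>

record store =
  nmem :: "nat \<Rightarrow> nat"
  rmem :: "nat \<Rightarrow> real"

datatype nexp =
    NConst nat
  | NLoad nexp
  | NAdd nexp nexp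
  | NSub nexp nexp

datatype rexp =
    RConst rat
  | RLoad nexp
  | RAdd rexp rexp
  | RSub rexp rexp
  | RMul rexp rexp
  | RDiv rexp rexp

datatype bexp =
    NLess nexp nexp
  | RLess rexp rexp
  | Neg bexp
  | Conj bexp bexp

datatype com =
    Skip
  | NStore nexp nexp
  | RStore nexp rexp
  | Query nexp nexp
  | Seq com com
  | Cond bexp com com
  | While bexp com

fun nval :: "nexp \<Rightarrow> store \<Rightarrow> nat" where
  "nval (NConst n) s = n"
| "nval (NLoad a) s = nmem s (nval a s)"
| "nval (NAdd a b) s = nval a s + nval b s"
| "nval (NSub a b) s = nval a s - nval b s"

fun rval :: "rexp \<Rightarrow> store \<Rightarrow> real" where
  "rval (RConst q) s = of_rat q"
| "rval (RLoad a) s = rmem s (nval a s)"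
| "rval (RAdd a b) s = rval a s + rval b s"
| "rval (RSub a b) s = rval a s - rval b s"
| "rval (RMul a b) s = rval a s * rval b s"
| "rval (RDiv a b) s = rval a s / rval b s"

fun bval :: "bexp \<Rightarrow> store \<Rightarrow> bool" where
  "bval (NLess a b) s \<longleftrightarrow> nval a s < nval b s"
| "bval (RLess a b) s \<longleftrightarrow> rval a s < rval b s"
| "bval (Neg p) s \<longleftrightarrow> \<not> bval p s"
| "bval (Conj p q) s \<longleftrightarrow> bval p s \<and> bval q s"

text \<open>Evaluating an expression costs one time step per node.\<close>

fun ncost :: "nexp \<Rightarrow> nat" where
  "ncost (NConst n) = 1"
| "ncost (NLoad a) = 1 + ncost a"
| "ncost (NAdd a b) = 1 + ncost a + ncost b"
| "ncost (NSub a b) = 1 + ncost a + ncost b"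

fun rcost :: "rexp \<Rightarrow> nat" where
  "rcost (RConst q) = 1"
| "rcost (RLoad a) = 1 + ncost a"
| "rcost (RAdd a b) = 1 + rcost a + rcost b"
| "rcost (RSub a b) = 1 + rcost a + rcost b"
| "rcost (RMul a b) = 1 + rcost a + rcost b"
| "rcost (RDiv a b) = 1 + rcost a + rcost b"

fun bcost :: "bexp \<Rightarrow> nat" where
  "bcost (NLess a b) = 1 + ncost a + ncost b"
| "bcost (RLess a b) = 1 + rcost a + rcost b"
| "bcost (Neg p) = 1 + bcost p"
| "bcost (Conj p q) = 1 + bcost p + bcost q"

definition read_vec :: "nat \<Rightarrow> nat \<Rightarrow> store \<Rightarrow> real vec" where
  "read_vec k a s = vec k (\<lambda>i. rmem s (a + i))"

definition write_vec :: "nat \<Rightarrow> real vec \<Rightarrow> store \<Rightarrow> store" where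
  "write_vec b v s =
     s\<lparr>rmem := (\<lambda>j. if b \<le> j \<and> j < b + dim_vec v then v $ (j - b) else rmem s j)\<rparr>"

text \<open>
  \<open>exec k f c s t s'\<close>: started in \<open>s\<close> with oracle \<open>f\<close> on the \<open>k\<close>-dimensional cube, the program
  \<open>c\<close> halts in \<open>s'\<close> after exactly \<open>t\<close> time steps.  \<open>Query a b\<close> sends the point stored in the \<open>k\<close>
  real cells from address \<open>a\<close> on to the oracle and stores the answer from address \<open>b\<close> on; the
  query itself is one step.  A program that queries a point outside the cube is stuck, i.e. it
  has no halting execution.
\<close>

inductive exec ::
  "nat \<Rightarrow> (real vec \<Rightarrow> real vec) \<Rightarrow> com \<Rightarrow> store \<Rightarrow> nat \<Rightarrow> store \<Rightarrow> bool"
  for k :: nat and f :: "real vec \<Rightarrow> real vec" where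
  Skip: "exec k f Skip s 1 s"
| NStore: "exec k f (NStore a e) s (1 + ncost a + ncost e)
             (s\<lparr>nmem := (nmem s)(nval a s := nval e s)\<rparr>)"
| RStore: "exec k f (RStore a e) s (1 + ncost a + rcost e)
             (s\<lparr>rmem := (rmem s)(nval a s := rval e s)\<rparr>)"
| Query: "read_vec k (nval a s) s \<in> unit_cube k \<Longrightarrow>
     exec k f (Query a b) s (1 + ncost a + ncost b)
       (write_vec (nval b s) (f (read_vec k (nval a s) s)) s)"
| Seq: "exec k f c s t s' \<Longrightarrow> exec k f d s' u s'' \<Longrightarrow> exec k f (Seq c d) s (t + u) s''"
| CondTrue: "bval p s \<Longrightarrow> exec k f c s t s' \<Longrightarrow>
     exec k f (Cond p c d) s (1 + bcost p + t) s'"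
| CondFalse: "\<not> bval p s \<Longrightarrow> exec k f d s t s' \<Longrightarrow>
     exec k f (Cond p c d) s (1 + bcost p + t) s'"
| WhileFalse: "\<not> bval p s \<Longrightarrow> exec k f (While p c) s (1 + bcost p) s"
| WhileTrue: "bval p s \<Longrightarrow> exec k f c s t s' \<Longrightarrow> exec k f (While p c) s' u s'' \<Longrightarrow>
     exec k f (While p c) s (1 + bcost p + t + u) s''"

inductive_cases exec_SkipE: "exec k f Skip s t s'"
inductive_cases exec_NStoreE: "exec k f (NStore a e) s t s'"
inductive_cases exec_RStoreE: "exec k f (RStore a e) s t s'"
inductive_cases exec_QueryE: "exec k f (Query a b) s t s'"
inductive_cases exec_SeqE: "exec k f (Seq c d) s t s'"
inductive_cases exec_CondE: "exec k f (Cond p c d) s t s'"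
inductive_cases exec_WhileE: "exec k f (While p c) s t s'"

lemma exec_deterministic:
  assumes "exec k f c s t s1" and "exec k f c s u s2"
  shows "t = u \<and> s1 = s2"
  using assms
proof (induction arbitrary: u s2 rule: exec.induct)
  case (Skip s)
  from Skip.prems show ?case by (rule exec_SkipE) simp
next
  case (NStore a e s)
  from NStore.prems show ?case by (rule exec_NStoreE) simp
next
  case (RStore a e s)
  from RStore.prems show ?case by (rule exec_RStoreE) simp
next
  case (Query a s b)
  from Query.prems show ?case by (rule exec_QueryE) simp
next
  case (Seq c s t s' d v s'')
  from Seq.prems obtain t1 r1 t2
    where r: "u = t1 + t2" "exec k f c s t1 r1" "exec k f d r1 t2 s2"
    by (rule exec_SeqE)
  with Seq.IH(1)[OF r(2)] Seq.IH(2) show ?case by metis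
next
  case (CondTrue p s c t s' d)
  from CondTrue.prems show ?case
  proof (rule exec_CondE)
    fix t1 assume "u = Suc (bcost p + t1)" "exec k f c s t1 s2"
    with CondTrue.IH[of t1 s2] show ?case by simp
  qed (use CondTrue.hyps in simp)
next
  case (CondFalse p s d t s' c)
  from CondFalse.prems show ?case
  proof (rule exec_CondE)
    fix t1 assume "u = Suc (bcost p + t1)" "exec k f d s t1 s2"
    with CondFalse.IH[of t1 s2] show ?case by simp
  qed (use CondFalse.hyps in simp)
next
  case (WhileFalse p s c)
  from WhileFalse.prems show ?case
    by (rule exec_WhileE) (use WhileFalse.hyps in simp_all)
next
  case (WhileTrue p s c t s' v s'')
  from WhileTrue.prems show ?case
  proof (rule exec_WhileE)
    fix t1 r1 t2
    assume r: "u = Suc (bcost p + t1 + t2)" "exec k f c s t1 r1" "exec k f (While p c) r1 t2 s2"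
    with WhileTrue.IH(1)[OF r(2)] WhileTrue.IH(2)[of t2 s2] show ?case by simp
  qed (use WhileTrue.hyps in simp)
qed

text \<open>
  Input: \<open>\<epsilon>\<close> in real cell 0 and \<open>k\<close> in natural-number cell 0, every other cell being zero.
  Output: the point held in real cells \<open>0, \<dots>, k - 1\<close> on halting.
\<close>

definition input_store :: "real \<Rightarrow> nat \<Rightarrow> store" where
  "input_store \<epsilon> k = \<lparr>nmem = (\<lambda>_. 0)(0 := k), rmem = (\<lambda>_. 0)(0 := \<epsilon>)\<rparr>"

definition output_point :: "nat \<Rightarrow> store \<Rightarrow> real vec" where
  "output_point k s = read_vec k 0 s"

text \<open>
  \<open>T \<epsilon>\<close> bounds the running time uniformly over all admissible oracles, i.e. in the worst case.
\<close>

definition solves_NonExp1_in_time :: "com \<Rightarrow> nat \<Rightarrow> (real \<Rightarrow> nat) \<Rightarrow> bool" where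
  "solves_NonExp1_in_time A k T \<longleftrightarrow>
     (\<forall>\<epsilon> f. 0 < \<epsilon> \<and> \<epsilon> \<le> 1 \<and> nonexpansive_l1 k f \<longrightarrow>
        (\<exists>t s. exec k f A (input_store \<epsilon> k) t s \<and> t \<le> T \<epsilon> \<and>
           eps_fixed_point k f \<epsilon> (output_point k s)))"

end

theory Submission imports Defs begin

text \<open>
  Pad the cube to dimension \<open>2n\<close> with \<open>n = \<lceil>k/2\<rceil>\<close>, the oracle answering \<open>0\<close> in a dummy
  coordinate, and search over one pair of coordinates at a time.  If for every value \<open>p\<close> of a pair
  the lower coordinates are set to a \<open>\<delta>\<close>-fixed point of the restricted map, then
  \<open>p\<close> is mapped to the pair \<open>G p\<close> of corresponding coordinates of the image, and nonexpansiveness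
  of \<open>f\<close> gives \<open>\<bar>G p - G q\<bar> \<le> \<bar>p - q\<bar> + 2\<delta>\<close> in the \<open>\<ell>\<^sub>1\<close>-norm.  So it suffices
  to find an \<open>O(\<eta>)\<close>-fixed point of an \<open>\<eta>\<close>-almost nonexpansive planar map with \<open>O(log (1/\<eta>))\<close>
  evaluations; nesting \<open>n\<close> such searches costs \<open>O(log\<^sup>n (1/\<epsilon>))\<close>.

  In the plane write \<open>(a, b) = G p - p\<close>, \<open>\<alpha> = a + b\<close> and \<open>\<beta> = a - b\<close>, so that the residual is
  \<open>max \<bar>\<alpha>\<bar> \<bar>\<beta>\<bar>\<close>.  Up to \<open>\<eta>\<close>, \<open>\<alpha>\<close> decreases in both coordinates, while \<open>\<beta>\<close> decreases in the first
  and increases in the second.  Evaluate at the centre of a box and move to the half towards which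
  the larger of \<open>\<bar>a\<bar>\<close>, \<open>\<bar>b\<bar>\<close> points; when one side is shorter than \<open>\<eta>\<close>, cut the other
  side instead.  The corners always satisfy \<open>\<alpha> \<ge> -O(\<eta>)\<close> (lower left), \<open>\<alpha> \<le> O(\<eta>)\<close> (upper
  right), \<open>\<beta> \<ge> -O(\<eta>)\<close> (upper left) and \<open>\<beta> \<le> O(\<eta>)\<close> (lower right), hence a
  box that is small in both directions consists of \<open>O(\<eta>)\<close>-fixed points.
\<close>

section \<open>Almost nonexpansive planar maps\<close>

text \<open>
  \<open>S x y u v\<close>: evaluating at \<open>(x, y)\<close> may return \<open>(u, v)\<close>.  A relation is used since the value
  depends on which approximate fixed point the lower levels find.
\<close>

locale planar_relation =
  fixes \<eta> :: real and S :: "real \<Rightarrow> real \<Rightarrow> real \<Rightarrow> real \<Rightarrow> bool"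
  assumes eta_nonneg: "0 \<le> \<eta>"
    and almost_nonexpansive: "S x y u v \<Longrightarrow> S x' y' u' v' \<Longrightarrow>
      \<bar>u - u'\<bar> + \<bar>v - v'\<bar> \<le> \<bar>x - x'\<bar> + \<bar>y - y'\<bar> + \<eta>"
    and range_unit: "S x y u v \<Longrightarrow> 0 \<le> u \<and> u \<le> 1 \<and> 0 \<le> v \<and> v \<le> 1"
begin

text \<open>The conditions are imposed on squares of side \<open>\<eta>\<close> at the corners
  rather than on the corners themselves. A box that is at most \<open>\<eta>\<close> wide in both
  directions is then covered by each of the four squares.\<close>

definition corners :: "real \<Rightarrow> real \<Rightarrow> real \<Rightarrow> real \<Rightarrow> bool" where
  "corners x0 x1 y0 y1 \<longleftrightarrow> (\<forall>x y u v. S x y u v \<longrightarrow>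
     (x0 \<le> x \<and> x \<le> x0 + \<eta> \<and> y0 \<le> y \<and> y \<le> y0 + \<eta> \<longrightarrow> - 8 * \<eta> \<le> (u - x) + (v - y)) \<and>
     (x1 - \<eta> \<le> x \<and> x \<le> x1 \<and> y1 - \<eta> \<le> y \<and> y \<le> y1 \<longrightarrow> (u - x) + (v - y) \<le> 8 * \<eta>) \<and>
     (x0 \<le> x \<and> x \<le> x0 + \<eta> \<and> y1 - \<eta> \<le> y \<and> y \<le> y1 \<longrightarrow> - 8 * \<eta> \<le> (u - x) - (v - y)) \<and>
     (x1 - \<eta> \<le> x \<and> x \<le> x1 \<and> y0 \<le> y \<and> y \<le> y0 + \<eta> \<longrightarrow> (u - x) - (v - y) \<le> 8 * \<eta>))"

text \<open>Each disjunction denies that both \<open>\<alpha>\<close> and \<open>\<beta>\<close>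
  point strongly out of the box through that edge.\<close>

definition vertical_edges :: "real \<Rightarrow> real \<Rightarrow> bool" where
  "vertical_edges x0 x1 \<longleftrightarrow> (\<forall>x y u v. S x y u v \<longrightarrow>
     (x0 \<le> x \<and> x \<le> x0 + \<eta> \<longrightarrow>
        - 3 * \<eta> \<le> (u - x) + (v - y) \<or> - 3 * \<eta> \<le> (u - x) - (v - y)) \<and>
     (x1 - \<eta> \<le> x \<and> x \<le> x1 \<longrightarrow>
        (u - x) + (v - y) \<le> 3 * \<eta> \<or> (u - x) - (v - y) \<le> 3 * \<eta>))"

definition horizontal_edges :: "real \<Rightarrow> real \<Rightarrow> bool" where
  "horizontal_edges y0 y1 \<longleftrightarrow> (\<forall>x y u v. S x y u v \<longrightarrow>
     (y0 \<le> y \<and> y \<le> y0 + \<eta> \<longrightarrow>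
        - 3 * \<eta> \<le> (u - x) + (v - y) \<or> (u - x) - (v - y) \<le> 3 * \<eta>) \<and>
     (y1 - \<eta> \<le> y \<and> y \<le> y1 \<longrightarrow>
        (u - x) + (v - y) \<le> 3 * \<eta> \<or> - 3 * \<eta> \<le> (u - x) - (v - y)))"

text \<open>
  By the cone argument, a centre that is pushed right establishes the left edge and both left
  corners of the right half (and similarly for the other directions).  Once the box is thinner
  than \<open>\<eta>\<close> in one direction, its two long edges decide every later cut, so the short edges
  need no longer be tracked.
\<close>

definition trapping :: "real \<Rightarrow> real \<Rightarrow> real \<Rightarrow> real \<Rightarrow> bool" where
  "trapping x0 x1 y0 y1 \<longleftrightarrow> corners x0 x1 y0 y1 \<and>
     (vertical_edges x0 x1 \<and> horizontal_edges y0 y1 \<or>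
      vertical_edges x0 x1 \<and> x1 - x0 \<le> \<eta> \<or>
      horizontal_edges y0 y1 \<and> y1 - y0 \<le> \<eta>)"

text \<open>The cone argument: \<open>\<bar>t\<bar> + t = 2 * max 0 t\<close>, so moving left or
  down costs \<open>\<alpha>\<close> nothing beyond \<open>\<eta>\<close>, while moving right or up
  costs twice the distance. For \<open>\<beta>\<close> the roles of up and down are
  exchanged.\<close>

lemma sum_displacement_ge:
  assumes "S x y u v" "S x' y' u' v'"
  shows "(u - x) + (v - y) - 2 * max 0 (x' - x) - 2 * max 0 (y' - y) - \<eta> \<le> (u' - x') + (v' - y')"
  using almost_nonexpansive[OF assms] by (simp add: max_def abs_if split: if_splits)

lemma difference_displacement_ge:
  assumes "S x y u v" "S x' y' u' v'"
  shows "(u - x) - (v - y) - 2 * max 0 (x' - x) - 2 * max 0 (y - y') - \<eta> \<le> (u' - x') - (v' - y')"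
  using almost_nonexpansive[OF assms] by (simp add: max_def abs_if split: if_splits)

lemma trapping_unit: "trapping 0 1 0 1"
proof -
  have "corners 0 1 0 1"
    unfolding corners_def using eta_nonneg by (auto dest!: range_unit)
  moreover have "vertical_edges 0 1"
    unfolding vertical_edges_def using eta_nonneg by (smt (verit) range_unit)
  moreover have "horizontal_edges 0 1"
    unfolding horizontal_edges_def using eta_nonneg by (smt (verit) range_unit)
  ultimately show ?thesis unfolding trapping_def by blast
qed

lemma trapping_small_box:
  assumes "trapping x0 x1 y0 y1" "x1 - x0 \<le> \<eta>" "y1 - y0 \<le> \<eta>"
    and "S x y u v" "x0 \<le> x" "x \<le> x1" "y0 \<le> y" "y \<le> y1"
  shows "\<bar>(u - x) + (v - y)\<bar> \<le> 8 * \<eta>" "\<bar>(u - x) - (v - y)\<bar> \<le> 8 * \<eta>"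
proof -
  have "corners x0 x1 y0 y1" using assms(1) by (simp add: trapping_def)
  from this[unfolded corners_def, rule_format, OF assms(4)] assms(2-)
  show "\<bar>(u - x) + (v - y)\<bar> \<le> 8 * \<eta>" "\<bar>(u - x) - (v - y)\<bar> \<le> 8 * \<eta>" by auto
qed

text \<open>A cut replaces two corners. Over a new corner square each coordinate moves by at most
  \<open>\<eta>\<close> in the costly direction, so the bound \<open>3 * \<eta>\<close> at the
  evaluated point degrades by \<open>2 * \<eta> + 2 * \<eta> + \<eta>\<close>, giving
  \<open>8 * \<eta>\<close>.\<close>

lemma corners_cut:
  assumes c: "corners x0 x1 y0 y1" and q: "S x y u v"
    and box: "x0 \<le> x" "x \<le> x1" "y0 \<le> y" "y \<le> y1"
  shows "- 3 * \<eta> \<le> (u - x) + (v - y) \<Longrightarrow> - 3 * \<eta> \<le> (u - x) - (v - y) \<Longrightarrow> corners x x1 y0 y1"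
    and "(u - x) + (v - y) \<le> 3 * \<eta> \<Longrightarrow> (u - x) - (v - y) \<le> 3 * \<eta> \<Longrightarrow> corners x0 x y0 y1"
    and "- 3 * \<eta> \<le> (u - x) + (v - y) \<Longrightarrow> (u - x) - (v - y) \<le> 3 * \<eta> \<Longrightarrow> corners x0 x1 y y1"
    and "(u - x) + (v - y) \<le> 3 * \<eta> \<Longrightarrow> - 3 * \<eta> \<le> (u - x) - (v - y) \<Longrightarrow> corners x0 x1 y0 y"
proof -
  note old = c[unfolded corners_def, rule_format]
  note facts = sum_displacement_ge[OF q] sum_displacement_ge[OF _ q]
    difference_displacement_ge[OF q] difference_displacement_ge[OF _ q]
  show "corners x x1 y0 y1" if "- 3 * \<eta> \<le> (u - x) + (v - y)" "- 3 * \<eta> \<le> (u - x) - (v - y)"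
    unfolding corners_def
  proof (intro allI impI)
    fix x' y' u' v' assume p: "S x' y' u' v'"
    show "(x \<le> x' \<and> x' \<le> x + \<eta> \<and> y0 \<le> y' \<and> y' \<le> y0 + \<eta> \<longrightarrow> - 8 * \<eta> \<le> (u' - x') + (v' - y')) \<and>
     (x1 - \<eta> \<le> x' \<and> x' \<le> x1 \<and> y1 - \<eta> \<le> y' \<and> y' \<le> y1 \<longrightarrow> (u' - x') + (v' - y') \<le> 8 * \<eta>) \<and>
     (x \<le> x' \<and> x' \<le> x + \<eta> \<and> y1 - \<eta> \<le> y' \<and> y' \<le> y1 \<longrightarrow> - 8 * \<eta> \<le> (u' - x') - (v' - y')) \<and>
     (x1 - \<eta> \<le> x' \<and> x' \<le> x1 \<and> y0 \<le> y' \<and> y' \<le> y0 + \<eta> \<longrightarrow> (u' - x') - (v' - y') \<le> 8 * \<eta>)"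
      using old[OF p] facts(1)[OF p] facts(3)[OF p] that box eta_nonneg
      by (auto simp: max_def split: if_splits)
  qed
  show "corners x0 x y0 y1" if "(u - x) + (v - y) \<le> 3 * \<eta>" "(u - x) - (v - y) \<le> 3 * \<eta>"
    unfolding corners_def
  proof (intro allI impI)
    fix x' y' u' v' assume p: "S x' y' u' v'"
    show "(x0 \<le> x' \<and> x' \<le> x0 + \<eta> \<and> y0 \<le> y' \<and> y' \<le> y0 + \<eta> \<longrightarrow> - 8 * \<eta> \<le> (u' - x') + (v' - y')) \<and>
     (x - \<eta> \<le> x' \<and> x' \<le> x \<and> y1 - \<eta> \<le> y' \<and> y' \<le> y1 \<longrightarrow> (u' - x') + (v' - y') \<le> 8 * \<eta>) \<and>
     (x0 \<le> x' \<and> x' \<le> x0 + \<eta> \<and> y1 - \<eta> \<le> y' \<and> y' \<le> y1 \<longrightarrow> - 8 * \<eta> \<le> (u' - x') - (v' - y')) \<and>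
     (x - \<eta> \<le> x' \<and> x' \<le> x \<and> y0 \<le> y' \<and> y' \<le> y0 + \<eta> \<longrightarrow> (u' - x') - (v' - y') \<le> 8 * \<eta>)"
      using old[OF p] facts(2)[OF p] facts(4)[OF p] that box eta_nonneg
      by (auto simp: max_def split: if_splits)
  qed
  show "corners x0 x1 y y1" if "- 3 * \<eta> \<le> (u - x) + (v - y)" "(u - x) - (v - y) \<le> 3 * \<eta>"
    unfolding corners_def
  proof (intro allI impI)
    fix x' y' u' v' assume p: "S x' y' u' v'"
    show "(x0 \<le> x' \<and> x' \<le> x0 + \<eta> \<and> y \<le> y' \<and> y' \<le> y + \<eta> \<longrightarrow> - 8 * \<eta> \<le> (u' - x') + (v' - y')) \<and>
     (x1 - \<eta> \<le> x' \<and> x' \<le> x1 \<and> y1 - \<eta> \<le> y' \<and> y' \<le> y1 \<longrightarrow> (u' - x') + (v' - y') \<le> 8 * \<eta>) \<and>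
     (x0 \<le> x' \<and> x' \<le> x0 + \<eta> \<and> y1 - \<eta> \<le> y' \<and> y' \<le> y1 \<longrightarrow> - 8 * \<eta> \<le> (u' - x') - (v' - y')) \<and>
     (x1 - \<eta> \<le> x' \<and> x' \<le> x1 \<and> y \<le> y' \<and> y' \<le> y + \<eta> \<longrightarrow> (u' - x') - (v' - y') \<le> 8 * \<eta>)"
      using old[OF p] facts(1)[OF p] facts(4)[OF p] that box eta_nonneg
      by (auto simp: max_def split: if_splits)
  qed
  show "corners x0 x1 y0 y" if "(u - x) + (v - y) \<le> 3 * \<eta>" "- 3 * \<eta> \<le> (u - x) - (v - y)"
    unfolding corners_def
  proof (intro allI impI)
    fix x' y' u' v' assume p: "S x' y' u' v'"
    show "(x0 \<le> x' \<and> x' \<le> x0 + \<eta> \<and> y0 \<le> y' \<and> y' \<le> y0 + \<eta> \<longrightarrow> - 8 * \<eta> \<le> (u' - x') + (v' - y')) \<and>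
     (x1 - \<eta> \<le> x' \<and> x' \<le> x1 \<and> y - \<eta> \<le> y' \<and> y' \<le> y \<longrightarrow> (u' - x') + (v' - y') \<le> 8 * \<eta>) \<and>
     (x0 \<le> x' \<and> x' \<le> x0 + \<eta> \<and> y - \<eta> \<le> y' \<and> y' \<le> y \<longrightarrow> - 8 * \<eta> \<le> (u' - x') - (v' - y')) \<and>
     (x1 - \<eta> \<le> x' \<and> x' \<le> x1 \<and> y0 \<le> y' \<and> y' \<le> y0 + \<eta> \<longrightarrow> (u' - x') - (v' - y') \<le> 8 * \<eta>)"
      using old[OF p] facts(2)[OF p] facts(3)[OF p] that box eta_nonneg
      by (auto simp: max_def split: if_splits)
  qed
qed

text \<open>In the strip next to the new edge, points below the evaluated point inherit the bound on
  one of \<open>\<alpha>\<close>, \<open>\<beta>\<close>, and points above it the bound on the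
  other. The loss is \<open>2 * \<eta>\<close> for the width of the strip plus
  \<open>\<eta>\<close>.\<close>

lemma vertical_edges_cut:
  assumes e: "vertical_edges x0 x1" and q: "S x y u v"
  shows "0 \<le> (u - x) + (v - y) \<Longrightarrow> 0 \<le> (u - x) - (v - y) \<Longrightarrow> vertical_edges x x1"
    and "(u - x) + (v - y) \<le> 0 \<Longrightarrow> (u - x) - (v - y) \<le> 0 \<Longrightarrow> vertical_edges x0 x"
proof -
  note old = e[unfolded vertical_edges_def, rule_format]
  show "vertical_edges x x1" if "0 \<le> (u - x) + (v - y)" "0 \<le> (u - x) - (v - y)"
    unfolding vertical_edges_def
  proof (intro allI impI)
    fix x' y' u' v' assume p: "S x' y' u' v'"
    show "(x \<le> x' \<and> x' \<le> x + \<eta> \<longrightarrow>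
        - 3 * \<eta> \<le> (u' - x') + (v' - y') \<or> - 3 * \<eta> \<le> (u' - x') - (v' - y')) \<and>
     (x1 - \<eta> \<le> x' \<and> x' \<le> x1 \<longrightarrow>
        (u' - x') + (v' - y') \<le> 3 * \<eta> \<or> (u' - x') - (v' - y') \<le> 3 * \<eta>)"
      using old[OF p] sum_displacement_ge[OF q p] difference_displacement_ge[OF q p] that
      by (auto simp: max_def split: if_splits)
  qed
  show "vertical_edges x0 x" if "(u - x) + (v - y) \<le> 0" "(u - x) - (v - y) \<le> 0"
    unfolding vertical_edges_def
  proof (intro allI impI)
    fix x' y' u' v' assume p: "S x' y' u' v'"
    show "(x0 \<le> x' \<and> x' \<le> x0 + \<eta> \<longrightarrow>
        - 3 * \<eta> \<le> (u' - x') + (v' - y') \<or> - 3 * \<eta> \<le> (u' - x') - (v' - y')) \<and>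
     (x - \<eta> \<le> x' \<and> x' \<le> x \<longrightarrow>
        (u' - x') + (v' - y') \<le> 3 * \<eta> \<or> (u' - x') - (v' - y') \<le> 3 * \<eta>)"
      using old[OF p] sum_displacement_ge[OF p q] difference_displacement_ge[OF p q] that
      by (auto simp: max_def split: if_splits)
  qed
qed

lemma horizontal_edges_cut:
  assumes e: "horizontal_edges y0 y1" and q: "S x y u v"
  shows "0 \<le> (u - x) + (v - y) \<Longrightarrow> (u - x) - (v - y) \<le> 0 \<Longrightarrow> horizontal_edges y y1"
    and "(u - x) + (v - y) \<le> 0 \<Longrightarrow> 0 \<le> (u - x) - (v - y) \<Longrightarrow> horizontal_edges y0 y"
proof -
  note old = e[unfolded horizontal_edges_def, rule_format]
  show "horizontal_edges y y1" if "0 \<le> (u - x) + (v - y)" "(u - x) - (v - y) \<le> 0"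
    unfolding horizontal_edges_def
  proof (intro allI impI)
    fix x' y' u' v' assume p: "S x' y' u' v'"
    show "(y \<le> y' \<and> y' \<le> y + \<eta> \<longrightarrow>
        - 3 * \<eta> \<le> (u' - x') + (v' - y') \<or> (u' - x') - (v' - y') \<le> 3 * \<eta>) \<and>
     (y1 - \<eta> \<le> y' \<and> y' \<le> y1 \<longrightarrow>
        (u' - x') + (v' - y') \<le> 3 * \<eta> \<or> - 3 * \<eta> \<le> (u' - x') - (v' - y'))"
      using old[OF p] sum_displacement_ge[OF q p] difference_displacement_ge[OF p q] that
      by (auto simp: max_def split: if_splits)
  qed
  show "horizontal_edges y0 y" if "(u - x) + (v - y) \<le> 0" "0 \<le> (u - x) - (v - y)"
    unfolding horizontal_edges_def
  proof (intro allI impI)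
    fix x' y' u' v' assume p: "S x' y' u' v'"
    show "(y0 \<le> y' \<and> y' \<le> y0 + \<eta> \<longrightarrow>
        - 3 * \<eta> \<le> (u' - x') + (v' - y') \<or> (u' - x') - (v' - y') \<le> 3 * \<eta>) \<and>
     (y - \<eta> \<le> y' \<and> y' \<le> y \<longrightarrow>
        (u' - x') + (v' - y') \<le> 3 * \<eta> \<or> - 3 * \<eta> \<le> (u' - x') - (v' - y'))"
      using old[OF p] sum_displacement_ge[OF p q] difference_displacement_ge[OF q p] that
      by (auto simp: max_def split: if_splits)
  qed
qed

text \<open>The product in \<open>cut_x\<close> is \<open>\<alpha> * \<beta> = a^2 - b^2\<close>, so
  its sign tells which of \<open>\<bar>a\<bar>\<close>, \<open>\<bar>b\<bar>\<close> is larger. In a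
  wide box this sign and that of the chosen displacement fix the signs of \<open>\<alpha>\<close>
  and \<open>\<beta>\<close>. In a thin box the long edges give bounds up to
  \<open>3 * \<eta>\<close> instead, which still suffice for the corners.\<close>

lemma trapping_cut:
  assumes t: "trapping x0 x1 y0 y1" and q: "S x y u v"
    and box: "x0 \<le> x" "x \<le> x1" "y0 \<le> y" "y \<le> y1"
    and far: "\<not> (\<bar>(u - x) + (v - y)\<bar> \<le> 8 * \<eta> \<and> \<bar>(u - x) - (v - y)\<bar> \<le> 8 * \<eta>)"
  defines "cut_x \<equiv> \<eta> < x1 - x0 \<and>
    (y1 - y0 \<le> \<eta> \<or> 0 \<le> ((u - x) + (v - y)) * ((u - x) - (v - y)))"
  shows "cut_x \<Longrightarrow> x < u \<Longrightarrow> trapping x x1 y0 y1"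
    and "cut_x \<Longrightarrow> \<not> x < u \<Longrightarrow> trapping x0 x y0 y1"
    and "\<not> cut_x \<Longrightarrow> \<eta> < x1 - x0 \<or> \<eta> < y1 - y0 \<Longrightarrow> y < v \<Longrightarrow> trapping x0 x1 y y1"
    and "\<not> cut_x \<Longrightarrow> \<eta> < x1 - x0 \<or> \<eta> < y1 - y0 \<Longrightarrow> \<not> y < v \<Longrightarrow> trapping x0 x1 y0 y"
proof -
  have c: "corners x0 x1 y0 y1" using t by (simp add: trapping_def)
  note cc = corners_cut[OF c q box]
  define \<alpha> where "\<alpha> = (u - x) + (v - y)"
  define \<beta> where "\<beta> = (u - x) - (v - y)"
  have ab: "2 * (u - x) = \<alpha> + \<beta>" "2 * (v - y) = \<alpha> - \<beta>"
    by (simp_all add: \<alpha>_def \<beta>_def)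
  have far': "8 * \<eta> < \<bar>\<alpha>\<bar> \<or> 8 * \<eta> < \<bar>\<beta>\<bar>" using far by (auto simp: \<alpha>_def \<beta>_def)
  note e0 = eta_nonneg
  \<comment> \<open>A box of width at most \<open>\<eta>\<close> lies inside both edge strips, so
    the edge conditions apply to the evaluated point itself.\<close>
  have vthin: "(- 3 * \<eta> \<le> \<alpha> \<or> - 3 * \<eta> \<le> \<beta>) \<and> (\<alpha> \<le> 3 * \<eta> \<or> \<beta> \<le> 3 * \<eta>)"
    if "vertical_edges x0 x1" "x1 - x0 \<le> \<eta>"
    using that(1)[unfolded vertical_edges_def, rule_format, OF q] that(2) box
    by (auto simp: \<alpha>_def \<beta>_def)
  have hthin: "(- 3 * \<eta> \<le> \<alpha> \<or> \<beta> \<le> 3 * \<eta>) \<and> (\<alpha> \<le> 3 * \<eta> \<or> - 3 * \<eta> \<le> \<beta>)"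
    if "horizontal_edges y0 y1" "y1 - y0 \<le> \<eta>"
    using that(1)[unfolded horizontal_edges_def, rule_format, OF q] that(2) box
    by (auto simp: \<alpha>_def \<beta>_def)
  show "trapping x x1 y0 y1" if X: "cut_x" and pos: "x < u"
  proof (cases "y1 - y0 \<le> \<eta>")
    case True
    have h: "horizontal_edges y0 y1" using t X True by (auto simp: trapping_def cut_x_def)
    have "- 3 * \<eta> \<le> \<alpha>" "- 3 * \<eta> \<le> \<beta>" using hthin[OF h True] far' pos ab e0 by (auto simp: abs_if split: if_splits)
    then show ?thesis using cc(1) h True by (auto simp: trapping_def \<alpha>_def \<beta>_def)
  next
    case False
    have h: "horizontal_edges y0 y1" "vertical_edges x0 x1"
      using t X False by (auto simp: trapping_def cut_x_def)
    have "0 \<le> \<alpha> * \<beta>" using X False by (simp add: cut_x_def \<alpha>_def \<beta>_def)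
    then have "0 \<le> \<alpha>" "0 \<le> \<beta>" using pos ab by (auto simp: zero_le_mult_iff)
    then show ?thesis using cc(1) vertical_edges_cut(1)[OF h(2) q] h e0
      by (auto simp: trapping_def \<alpha>_def \<beta>_def)
  qed
  show "trapping x0 x y0 y1" if X: "cut_x" and pos: "\<not> x < u"
  proof (cases "y1 - y0 \<le> \<eta>")
    case True
    have h: "horizontal_edges y0 y1" using t X True by (auto simp: trapping_def cut_x_def)
    have "\<alpha> \<le> 3 * \<eta>" "\<beta> \<le> 3 * \<eta>" using hthin[OF h True] far' pos ab e0 by (auto simp: abs_if split: if_splits)
    then show ?thesis using cc(2) h True by (auto simp: trapping_def \<alpha>_def \<beta>_def)
  next
    case False
    have h: "horizontal_edges y0 y1" "vertical_edges x0 x1"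
      using t X False by (auto simp: trapping_def cut_x_def)
    have "0 \<le> \<alpha> * \<beta>" using X False by (simp add: cut_x_def \<alpha>_def \<beta>_def)
    then have "\<alpha> \<le> 0" "\<beta> \<le> 0" using pos ab far' e0 by (auto simp: zero_le_mult_iff)
    then show ?thesis using cc(2) vertical_edges_cut(2)[OF h(2) q] h e0
      by (auto simp: trapping_def \<alpha>_def \<beta>_def)
  qed
  show "trapping x0 x1 y y1"
    if X: "\<not> cut_x" and wide: "\<eta> < x1 - x0 \<or> \<eta> < y1 - y0" and pos: "y < v"
  proof (cases "x1 - x0 \<le> \<eta>")
    case True
    have h: "vertical_edges x0 x1" using t wide True by (auto simp: trapping_def)
    have "- 3 * \<eta> \<le> \<alpha>" "\<beta> \<le> 3 * \<eta>" using vthin[OF h True] far' pos ab e0 by (auto simp: abs_if split: if_splits)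
    then show ?thesis using cc(3) h True by (auto simp: trapping_def \<alpha>_def \<beta>_def)
  next
    case False
    have h: "horizontal_edges y0 y1" "vertical_edges x0 x1"
      using t X False by (auto simp: trapping_def cut_x_def)
    have "\<alpha> * \<beta> < 0" using X False by (auto simp: cut_x_def \<alpha>_def \<beta>_def)
    then have "0 \<le> \<alpha>" "\<beta> \<le> 0" using pos ab by (auto simp: mult_less_0_iff)
    then show ?thesis using cc(3) horizontal_edges_cut(1)[OF h(1) q] h e0
      by (auto simp: trapping_def \<alpha>_def \<beta>_def)
  qed
  show "trapping x0 x1 y0 y"
    if X: "\<not> cut_x" and wide: "\<eta> < x1 - x0 \<or> \<eta> < y1 - y0" and pos: "\<not> y < v"
  proof (cases "x1 - x0 \<le> \<eta>")
    case True
    have h: "vertical_edges x0 x1" using t wide True by (auto simp: trapping_def)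
    have "\<alpha> \<le> 3 * \<eta>" "- 3 * \<eta> \<le> \<beta>" using vthin[OF h True] far' pos ab e0 by (auto simp: abs_if split: if_splits)
    then show ?thesis using cc(4) h True by (auto simp: trapping_def \<alpha>_def \<beta>_def)
  next
    case False
    have h: "horizontal_edges y0 y1" "vertical_edges x0 x1"
      using t X False by (auto simp: trapping_def cut_x_def)
    have "\<alpha> * \<beta> < 0" using X False by (auto simp: cut_x_def \<alpha>_def \<beta>_def)
    then have "\<alpha> \<le> 0" "0 \<le> \<beta>" using pos ab by (auto simp: mult_less_0_iff)
    then show ?thesis using cc(4) horizontal_edges_cut(2)[OF h(1) q] h e0
      by (auto simp: trapping_def \<alpha>_def \<beta>_def)
  qed
qed

end

section \<open>The program\<close>

definition halts_within ::
  "nat \<Rightarrow> (real vec \<Rightarrow> real vec) \<Rightarrow> com \<Rightarrow> nat \<Rightarrow> store \<Rightarrow> store \<Rightarrow> bool" where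
  "halts_within k f c T s s' \<longleftrightarrow> (\<exists>t\<le>T. exec k f c s t s')"

lemma halts_within_Seq:
  assumes "halts_within k f c T s s'" "halts_within k f d U s' s''"
  shows "halts_within k f (Seq c d) (T + U) s s''"
  using assms unfolding halts_within_def by (meson add_mono exec.Seq)

lemma halts_within_RStore:
  "halts_within k f (RStore a e) (1 + ncost a + rcost e) s
     (s\<lparr>rmem := (rmem s)(nval a s := rval e s)\<rparr>)"
  unfolding halts_within_def using exec.RStore by blast

lemma halts_within_CondTrue:
  "bval p s \<Longrightarrow> halts_within k f c T s s' \<Longrightarrow> halts_within k f (Cond p c d) (1 + bcost p + T) s s'"
  unfolding halts_within_def using exec.CondTrue by (meson add_left_mono)

lemma halts_within_CondFalse:
  "\<not> bval p s \<Longrightarrow> halts_within k f d T s s' \<Longrightarrow> halts_within k f (Cond p c d) (1 + bcost p + T) s s'"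
  unfolding halts_within_def using exec.CondFalse by (meson add_left_mono)

lemma halts_within_WhileFalse:
  "\<not> bval p s \<Longrightarrow> halts_within k f (While p c) (1 + bcost p) s s"
  unfolding halts_within_def using exec.WhileFalse by blast

lemma halts_within_WhileTrue:
  assumes "bval p s" "halts_within k f c T s s'" "halts_within k f (While p c) U s' s''"
  shows "halts_within k f (While p c) (1 + bcost p + T + U) s s''"
proof -
  obtain t u where "t \<le> T" "u \<le> U" "exec k f c s t s'" "exec k f (While p c) s' u s''"
    using assms(2,3) unfolding halts_within_def by blast
  then have "exec k f (While p c) s (1 + bcost p + t + u) s''"
    and "1 + bcost p + t + u \<le> 1 + bcost p + T + U"
    using exec.WhileTrue[OF assms(1)] by (blast, simp)
  then show ?thesis unfolding halts_within_def by blast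
qed

lemma halts_within_mono: "halts_within k f c T s s' \<Longrightarrow> T \<le> U \<Longrightarrow> halts_within k f c U s s'"
  unfolding halts_within_def using order_trans by blast

definition cell :: "nat \<Rightarrow> rexp" where
  "cell a = RLoad (NConst a)"

definition put :: "nat \<Rightarrow> rexp \<Rightarrow> com" where
  "put a e = RStore (NConst a) e"

lemma rval_cell [simp]: "rval (cell a) s = rmem s a"
  by (simp add: cell_def)

lemma rcost_cell [simp]: "rcost (cell a) = 2"
  by (simp add: cell_def)

lemma halts_within_put:
  "halts_within k f (put a e) (2 + rcost e) s (s\<lparr>rmem := (rmem s)(a := rval e s)\<rparr>)"
  using halts_within_RStore[of k f "NConst a" e s] by (simp add: put_def)

text \<open>
  Real memory: the current point in cells \<open>0, \<dots>, 2n - 1\<close>, its image in cells \<open>2n, \<dots>, 4n - 1\<close>,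
  \<open>\<epsilon>\<close> in cell \<open>4n\<close>, and the box \<open>[x0, x1] \<times> [y0, y1]\<close> of level \<open>j\<close> in the four cells from
  \<open>box n j\<close> on.  Level \<open>j\<close> searches over the coordinates \<open>2j\<close> and \<open>2j + 1\<close>.
\<close>

definition box :: "nat \<Rightarrow> nat \<Rightarrow> nat" where
  "box n j = 4 * n + 1 + 4 * j"

text \<open>The \<open>\<eta>\<close> of level \<open>j\<close>, twice the residual allowed to the
  levels below: two evaluations each contribute one such residual.\<close>

definition slack :: "nat \<Rightarrow> nat \<Rightarrow> rexp" where
  "slack n j = RMul (cell (4 * n)) (RConst (2 * 17 ^ j / 17 ^ n))"

definition dx :: "nat \<Rightarrow> nat \<Rightarrow> rexp" where
  "dx n j = RSub (cell (2 * n + 2 * j)) (cell (2 * j))"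

definition dy :: "nat \<Rightarrow> nat \<Rightarrow> rexp" where
  "dy n j = RSub (cell (2 * n + (2 * j + 1))) (cell (2 * j + 1))"

definition abs_le :: "rexp \<Rightarrow> rexp \<Rightarrow> bexp" where
  "abs_le e b = Conj (Neg (RLess b e)) (Neg (RLess e (RSub (RConst 0) b)))"

definition near :: "nat \<Rightarrow> nat \<Rightarrow> bexp" where
  "near n j = Conj (abs_le (RAdd (dx n j) (dy n j)) (RMul (RConst 8) (slack n j)))
                   (abs_le (RSub (dx n j) (dy n j)) (RMul (RConst 8) (slack n j)))"

text \<open>The nested negation expresses a disjunction: the second side is short, or the product of
  \<open>\<alpha>\<close> and \<open>\<beta>\<close> is nonnegative.\<close>

definition cut_x :: "nat \<Rightarrow> nat \<Rightarrow> bexp" where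
  "cut_x n j =
     Conj (RLess (slack n j) (RSub (cell (box n j + 1)) (cell (box n j))))
       (Neg (Conj (RLess (slack n j) (RSub (cell (box n j + 3)) (cell (box n j + 2))))
                  (RLess (RMul (RAdd (dx n j) (dy n j)) (RSub (dx n j) (dy n j))) (RConst 0))))"

definition cut :: "nat \<Rightarrow> nat \<Rightarrow> com" where
  "cut n j = Cond (cut_x n j)
     (Cond (RLess (cell (2 * j)) (cell (2 * n + 2 * j)))
       (put (box n j) (cell (2 * j))) (put (box n j + 1) (cell (2 * j))))
     (Cond (RLess (cell (2 * j + 1)) (cell (2 * n + (2 * j + 1))))
       (put (box n j + 2) (cell (2 * j + 1))) (put (box n j + 3) (cell (2 * j + 1))))"

definition reset_box :: "nat \<Rightarrow> nat \<Rightarrow> com" where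
  "reset_box n j = Seq (Seq (put (box n j) (RConst 0)) (put (box n j + 1) (RConst 1)))
                       (Seq (put (box n j + 2) (RConst 0)) (put (box n j + 3) (RConst 1)))"

definition centre :: "nat \<Rightarrow> nat \<Rightarrow> com" where
  "centre n j =
     Seq (put (2 * j) (RDiv (RAdd (cell (box n j)) (cell (box n j + 1))) (RConst 2)))
       (put (2 * j + 1) (RDiv (RAdd (cell (box n j + 2)) (cell (box n j + 3))) (RConst 2)))"

text \<open>Every call starts again from the whole unit square, because the planar map of a level
  changes with the coordinates set by the levels above. The loop is entered with the centre already
  evaluated.\<close>

fun search :: "nat \<Rightarrow> nat \<Rightarrow> com" where
  "search n 0 = Query (NConst 0) (NConst (2 * n))"
| "search n (Suc j) = Seq (reset_box n j) (Seq (Seq (centre n j) (search n j))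
     (While (Neg (near n j)) (Seq (cut n j) (Seq (centre n j) (search n j)))))"

definition padded :: "nat \<Rightarrow> (real vec \<Rightarrow> real vec) \<Rightarrow> (nat \<Rightarrow> real) \<Rightarrow> nat \<Rightarrow> real" where
  "padded k f p i = (if i < k then f (vec k p) $ i else 0)"

definition in_cube :: "nat \<Rightarrow> (nat \<Rightarrow> real) \<Rightarrow> bool" where
  "in_cube n p \<longleftrightarrow> (\<forall>i<2 * n. 0 \<le> p i \<and> p i \<le> 1)"

definition residual :: "nat \<Rightarrow> (real vec \<Rightarrow> real vec) \<Rightarrow> nat \<Rightarrow> (nat \<Rightarrow> real) \<Rightarrow> real" where
  "residual k f j p = (\<Sum>i<2 * j. \<bar>padded k f p i - p i\<bar>)"

section \<open>Correctness and running time\<close>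

locale nonexpansive_oracle =
  fixes k :: nat and f :: "real vec \<Rightarrow> real vec" and n :: nat and \<epsilon> :: real
  assumes nonexp: "nonexpansive_l1 k f" and k_le: "k \<le> 2 * n" and eps_pos: "0 < \<epsilon>"
begin

abbreviation g :: "(nat \<Rightarrow> real) \<Rightarrow> nat \<Rightarrow> real" where
  "g \<equiv> padded k f"

text \<open>The residual allowed after level \<open>j\<close>. A level adds at most
  \<open>8 * (2 * err j)\<close>, so the factor per level is \<open>1 + 16 = 17\<close>, and
  \<open>err n\<close> is \<open>\<epsilon>\<close>.\<close>

abbreviation err :: "nat \<Rightarrow> real" where
  "err j \<equiv> \<epsilon> * 17 ^ j / 17 ^ n"

lemma vec_in_unit_cube: "in_cube n p \<Longrightarrow> vec k p \<in> unit_cube k"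
  using k_le by (auto simp: in_cube_def unit_cube_def)

lemma image_in_unit_cube: "in_cube n p \<Longrightarrow> f (vec k p) \<in> unit_cube k"
  using vec_in_unit_cube nonexp by (auto simp: nonexpansive_l1_def)

lemma padded_unit: "in_cube n p \<Longrightarrow> 0 \<le> g p i \<and> g p i \<le> 1"
  using image_in_unit_cube[of p] by (auto simp: padded_def unit_cube_def)

lemma padded_nonexpansive:
  assumes p: "in_cube n p" and q: "in_cube n q"
  shows "(\<Sum>i<2 * n. \<bar>g p i - g q i\<bar>) \<le> (\<Sum>i<2 * n. \<bar>p i - q i\<bar>)"
proof -
  have d: "dim_vec (f (vec k p)) = k" "dim_vec (f (vec k q)) = k"
    using image_in_unit_cube[OF p] image_in_unit_cube[OF q] by (auto simp: unit_cube_def)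
  have sub: "{..<k} \<subseteq> {..<2 * n}" using k_le by auto
  have "(\<Sum>i<2 * n. \<bar>g p i - g q i\<bar>) = (\<Sum>i<k. \<bar>g p i - g q i\<bar>)"
    by (rule sum.mono_neutral_right) (use k_le in \<open>auto simp: padded_def\<close>)
  also have "\<dots> = l1_norm (f (vec k p) - f (vec k q))"
    by (simp add: l1_norm_def d padded_def)
  also have "\<dots> \<le> l1_norm (vec k p - vec k q)"
    using nonexp vec_in_unit_cube[OF p] vec_in_unit_cube[OF q] by (simp add: nonexpansive_l1_def)
  also have "\<dots> = (\<Sum>i<k. \<bar>p i - q i\<bar>)"
    by (simp add: l1_norm_def)
  also have "\<dots> \<le> (\<Sum>i<2 * n. \<bar>p i - q i\<bar>)"
    by (rule sum_mono2) (use sub in auto)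
  finally show ?thesis .
qed

definition slice :: "nat \<Rightarrow> (nat \<Rightarrow> real) \<Rightarrow> real \<Rightarrow> real \<Rightarrow> real \<Rightarrow> real \<Rightarrow> bool" where
  "slice j z x y u v \<longleftrightarrow> (\<exists>p. in_cube n p \<and> (\<forall>i. 2 * Suc j \<le> i \<and> i < 2 * n \<longrightarrow> p i = z i) \<and>
     residual k f j p \<le> err j \<and>
     x = p (2 * j) \<and> y = p (2 * j + 1) \<and> u = g p (2 * j) \<and> v = g p (2 * j + 1))"

lemma sum_split_slice:
  fixes h :: "nat \<Rightarrow> real"
  assumes "j < n"
  shows "(\<Sum>i<2 * n. h i) =
    (\<Sum>i<2 * j. h i) + h (2 * j) + h (2 * j + 1) + (\<Sum>i\<in>{2 * Suc j..<2 * n}. h i)"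
proof -
  have "(\<Sum>i<2 * n. h i) = (\<Sum>i<2 * Suc j. h i) + (\<Sum>i\<in>{2 * Suc j..<2 * n}. h i)"
    unfolding lessThan_atLeast0
    using sum.atLeastLessThan_concat[of 0 "2 * Suc j" "2 * n" h] assms by simp
  then show ?thesis by simp
qed

text \<open>On the lower coordinates the triangle inequality bounds the distance of the points by
  that of their images plus two residuals. The higher coordinates agree, so after subtracting the
  lower sums from nonexpansiveness only the pair remains.\<close>

lemma planar_relation_slice:
  assumes "j < n"
  shows "planar_relation (2 * err j) (slice j z)"
proof
  show "0 \<le> 2 * err j" using eps_pos by simp
next
  fix x y u v x' y' u' v'
  assume "slice j z x y u v" "slice j z x' y' u' v'"
  then obtain p q where
    p: "in_cube n p" "\<forall>i. 2 * Suc j \<le> i \<and> i < 2 * n \<longrightarrow> p i = z i" "residual k f j p \<le> err j"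
      "x = p (2 * j)" "y = p (2 * j + 1)" "u = g p (2 * j)" "v = g p (2 * j + 1)"
    and q: "in_cube n q" "\<forall>i. 2 * Suc j \<le> i \<and> i < 2 * n \<longrightarrow> q i = z i" "residual k f j q \<le> err j"
      "x' = q (2 * j)" "y' = q (2 * j + 1)" "u' = g q (2 * j)" "v' = g q (2 * j + 1)"
    unfolding slice_def by blast
  have "(\<Sum>i<2 * j. \<bar>p i - q i\<bar>) \<le>
      (\<Sum>i<2 * j. \<bar>g p i - p i\<bar> + \<bar>g p i - g q i\<bar> + \<bar>g q i - q i\<bar>)"
    by (rule sum_mono) linarith
  also have "\<dots> = residual k f j p + (\<Sum>i<2 * j. \<bar>g p i - g q i\<bar>) + residual k f j q"
    by (simp add: sum.distrib residual_def)
  finally have low: "(\<Sum>i<2 * j. \<bar>p i - q i\<bar>) \<le> (\<Sum>i<2 * j. \<bar>g p i - g q i\<bar>) + 2 * err j"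
    using p(3) q(3) by linarith
  have "(\<Sum>i\<in>{2 * Suc j..<2 * n}. \<bar>p i - q i\<bar>) = 0"
    using p(2) q(2) by (intro sum.neutral) auto
  moreover have "0 \<le> (\<Sum>i\<in>{2 * Suc j..<2 * n}. \<bar>g p i - g q i\<bar>)"
    by (simp add: sum_nonneg)
  ultimately show "\<bar>u - u'\<bar> + \<bar>v - v'\<bar> \<le> \<bar>x - x'\<bar> + \<bar>y - y'\<bar> + 2 * err j"
    using padded_nonexpansive[OF p(1) q(1)] low
    unfolding sum_split_slice[OF assms] p(4-) q(4-) by linarith
next
  fix x y u v assume "slice j z x y u v"
  then show "0 \<le> u \<and> u \<le> 1 \<and> 0 \<le> v \<and> v \<le> 1"
    unfolding slice_def using padded_unit by blast
qed

section \<open>Memory invariants and the induction statement\<close>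

definition frame :: "nat \<Rightarrow> store \<Rightarrow> store \<Rightarrow> bool" where
  "frame j s s' \<longleftrightarrow> (\<forall>i. 2 * j \<le> i \<and> i < 2 * n \<or> 2 * n + k \<le> i \<and> i \<le> 4 * n \<or> box n j \<le> i \<longrightarrow>
     rmem s' i = rmem s i)"

definition ready :: "nat \<Rightarrow> store \<Rightarrow> bool" where
  "ready j s \<longleftrightarrow> rmem s (4 * n) = \<epsilon> \<and> (\<forall>i. 2 * j \<le> i \<and> i < 2 * n \<longrightarrow> 0 \<le> rmem s i \<and> rmem s i \<le> 1) \<and>
     (\<forall>i. 2 * n + k \<le> i \<and> i < 4 * n \<longrightarrow> rmem s i = 0)"

definition evaluated :: "store \<Rightarrow> bool" where
  "evaluated s \<longleftrightarrow> in_cube n (rmem s) \<and> (\<forall>i<2 * n. rmem s (2 * n + i) = g (rmem s) i)"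

text \<open>The statement proved by induction on \<open>j\<close>. The lower coordinates and boxes
  may hold anything on entry, while \<open>frame\<close> guarantees that the calling level finds its
  own box and coordinates intact.\<close>

definition solves :: "nat \<Rightarrow> nat \<Rightarrow> bool" where
  "solves j T \<longleftrightarrow> (\<forall>s. ready j s \<longrightarrow> (\<exists>s'. halts_within k f (search n j) T s s' \<and> frame j s s' \<and>
     evaluated s' \<and> residual k f j (rmem s') \<le> err j))"

lemma solves_0: "solves 0 3"
  unfolding solves_def
proof (intro allI impI)
  fix s assume r: "ready 0 s"
  then have c: "in_cube n (rmem s)" by (simp add: ready_def in_cube_def)
  define s' where "s' = write_vec (2 * n) (f (vec k (rmem s))) s"
  have d: "dim_vec (f (vec k (rmem s))) = k"
    using image_in_unit_cube[OF c] by (auto simp: unit_cube_def)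
  have mem: "rmem s' i = (if 2 * n \<le> i \<and> i < 2 * n + k then g (rmem s) (i - 2 * n) else rmem s i)" for i
    by (auto simp: s'_def write_vec_def d padded_def)
  have rv: "read_vec k 0 s = vec k (rmem s)" by (simp add: read_vec_def)
  have "exec k f (Query (NConst 0) (NConst (2 * n))) s 3 s'"
    using exec.Query[of k "NConst 0" s f "NConst (2 * n)"] vec_in_unit_cube[OF c]
    by (simp add: rv s'_def numeral_3_eq_3)
  then have "halts_within k f (search n 0) 3 s s'" by (auto simp: halts_within_def)
  moreover have "frame 0 s s'" using k_le by (auto simp: frame_def mem box_def)
  \<comment> \<open>The answer is written from cell \<open>2 * n\<close> on, beyond the
    \<open>k\<close> cells of the query point, so the point survives.\<close>
  moreover have "vec k (rmem s') = vec k (rmem s)" using k_le by (auto simp: mem)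
  then have g: "g (rmem s') = g (rmem s)" by (auto simp: padded_def)
  have "evaluated s'"
    using c r k_le unfolding evaluated_def g in_cube_def
    by (auto simp: mem ready_def) (simp add: padded_def)
  moreover have "residual k f 0 (rmem s') \<le> err 0" using eps_pos by (simp add: residual_def)
  ultimately show "\<exists>s'. halts_within k f (search n 0) 3 s s' \<and> frame 0 s s' \<and>
     evaluated s' \<and> residual k f 0 (rmem s') \<le> err 0" by blast
qed

lemma frame_trans: "frame j s s' \<Longrightarrow> frame j s' s'' \<Longrightarrow> frame j s s''"
  by (simp add: frame_def)

lemma frame_mono: "frame j s s' \<Longrightarrow> j \<le> j' \<Longrightarrow> frame j' s s'"
  by (auto simp: frame_def box_def)

lemma ready_frame: "ready j s \<Longrightarrow> frame j s s' \<Longrightarrow> ready j s'"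
  using k_le by (auto simp: ready_def frame_def)

lemma slack_eq: "rmem s (4 * n) = \<epsilon> \<Longrightarrow> rval (slack n j) s = 2 * err j"
  by (simp add: slack_def of_rat_mult of_rat_divide of_rat_power)

lemma bval_near:
  assumes "rmem s (4 * n) = \<epsilon>"
  shows "bval (near n j) s \<longleftrightarrow>
    \<bar>rval (dx n j) s + rval (dy n j) s\<bar> \<le> 8 * (2 * err j) \<and>
    \<bar>rval (dx n j) s - rval (dy n j) s\<bar> \<le> 8 * (2 * err j)"
  by (auto simp: near_def abs_le_def slack_eq[OF assms])

section \<open>Effect and cost of the program fragments\<close>

lemma halts_within_reset_box:
  "\<exists>s'. halts_within k f (reset_box n j) 12 s s' \<and>
     rmem s' = (rmem s)(box n j := 0, box n j + 1 := 1, box n j + 2 := 0, box n j + 3 := 1)"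
proof -
  have "\<exists>s'. halts_within k f (reset_box n j) ((3 + 3) + (3 + 3)) s s' \<and>
     rmem s' = (rmem s)(box n j := 0, box n j + 1 := 1, box n j + 2 := 0, box n j + 3 := 1)"
    unfolding reset_box_def
    by (rule exI, rule conjI, (rule halts_within_Seq halts_within_put[where e = "RConst _", simplified])+) simp
  then show ?thesis by simp
qed

lemma halts_within_centre:
  assumes "j < n"
  shows "\<exists>s'. halts_within k f (centre n j) 18 s s' \<and>
    rmem s' = (rmem s)(2 * j := (rmem s (box n j) + rmem s (box n j + 1)) / 2,
      2 * j + 1 := (rmem s (box n j + 2) + rmem s (box n j + 3)) / 2)"
proof -
  define e1 where "e1 = RDiv (RAdd (cell (box n j)) (cell (box n j + 1))) (RConst 2)"
  define e2 where "e2 = RDiv (RAdd (cell (box n j + 2)) (cell (box n j + 3))) (RConst 2)"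
  define s1 where "s1 = s\<lparr>rmem := (rmem s)(2 * j := rval e1 s)\<rparr>"
  define s2 where "s2 = s1\<lparr>rmem := (rmem s1)(2 * j + 1 := rval e2 s1)\<rparr>"
  have "halts_within k f (centre n j) ((2 + rcost e1) + (2 + rcost e2)) s s2"
    unfolding centre_def e1_def[symmetric] e2_def[symmetric]
    by (rule halts_within_Seq[where s' = s1]) (simp_all only: s1_def s2_def halts_within_put)
  then have "halts_within k f (centre n j) 18 s s2" by (simp add: e1_def e2_def)
  \<comment> \<open>The box lies beyond cell \<open>4 * n\<close>, so writing the first coordinate
    does not disturb the sides read by the second assignment.\<close>
  moreover have "box n j + i \<noteq> 2 * j" for i using assms by (simp add: box_def)
  from this[of 2] this[of 3]
  have "rmem s2 = (rmem s)(2 * j := (rmem s (box n j) + rmem s (box n j + 1)) / 2,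
      2 * j + 1 := (rmem s (box n j + 2) + rmem s (box n j + 3)) / 2)"
    by (simp add: s2_def s1_def e1_def e2_def)
  ultimately show ?thesis by blast
qed

lemma halts_within_cut:
  fixes j :: nat
  assumes eps: "rmem s (4 * n) = \<epsilon>"
  defines "w \<equiv> 2 * err j" and "a \<equiv> rval (dx n j) s" and "b \<equiv> rval (dy n j) s"
  defines "r \<equiv> (if w < rmem s (box n j + 1) - rmem s (box n j) \<and>
      (rmem s (box n j + 3) - rmem s (box n j + 2) \<le> w \<or> 0 \<le> (a + b) * (a - b))
    then (rmem s)((if rmem s (2 * j) < rmem s (2 * n + 2 * j) then box n j else box n j + 1) :=
      rmem s (2 * j))
    else (rmem s)((if rmem s (2 * j + 1) < rmem s (2 * n + (2 * j + 1))
      then box n j + 2 else box n j + 3) := rmem s (2 * j + 1)))"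
  shows "\<exists>s'. halts_within k f (cut n j) 60 s s' \<and> rmem s' = r"
proof -
  have cx: "bval (cut_x n j) s \<longleftrightarrow> w < rmem s (box n j + 1) - rmem s (box n j) \<and>
      (rmem s (box n j + 3) - rmem s (box n j + 2) \<le> w \<or> 0 \<le> (a + b) * (a - b))"
    by (auto simp: cut_x_def slack_eq[OF eps] w_def a_def b_def)
  have cost: "bcost (cut_x n j) = 48"
    by (simp add: cut_x_def slack_def dx_def dy_def)
  have inner: "\<exists>s'. halts_within k f (Cond (RLess (cell c) (cell d)) (put l (cell c)) (put h (cell c))) 10 s s' \<and>
      rmem s' = (rmem s)((if rmem s c < rmem s d then l else h) := rmem s c)" for c d l h
  proof (cases "rmem s c < rmem s d")
    case True
    then show ?thesis
      using halts_within_CondTrue[of "RLess (cell c) (cell d)" s k f, OF _ halts_within_put[of k f l "cell c" s]]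
      by (intro exI conjI) (auto intro: halts_within_mono)
  next
    case False
    then show ?thesis
      using halts_within_CondFalse[of "RLess (cell c) (cell d)" s k f, OF _ halts_within_put[of k f h "cell c" s]]
      by (intro exI conjI) (auto intro: halts_within_mono)
  qed
  show ?thesis
  proof (cases "bval (cut_x n j) s")
    case True
    obtain s' where "halts_within k f (Cond (RLess (cell (2 * j)) (cell (2 * n + 2 * j)))
        (put (box n j) (cell (2 * j))) (put (box n j + 1) (cell (2 * j)))) 10 s s'"
      and m: "rmem s' = (rmem s)((if rmem s (2 * j) < rmem s (2 * n + 2 * j)
        then box n j else box n j + 1) := rmem s (2 * j))"
      using inner by blast
    from halts_within_CondTrue[OF True this(1)] have "halts_within k f (cut n j) 60 s s'"
      unfolding cut_def by (rule halts_within_mono) (simp add: cost)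
    moreover have "rmem s' = r" unfolding r_def if_P[OF True[unfolded cx]] by (rule m)
    ultimately show ?thesis by blast
  next
    case False
    obtain s' where "halts_within k f (Cond (RLess (cell (2 * j + 1)) (cell (2 * n + (2 * j + 1))))
        (put (box n j + 2) (cell (2 * j + 1))) (put (box n j + 3) (cell (2 * j + 1)))) 10 s s'"
      and m: "rmem s' = (rmem s)((if rmem s (2 * j + 1) < rmem s (2 * n + (2 * j + 1))
        then box n j + 2 else box n j + 3) := rmem s (2 * j + 1))"
      using inner by blast
    from halts_within_CondFalse[OF False this(1)] have "halts_within k f (cut n j) 60 s s'"
      unfolding cut_def by (rule halts_within_mono) (simp add: cost)
    moreover have "rmem s' = r" unfolding r_def if_not_P[OF False[unfolded cx]] by (rule m)
    ultimately show ?thesis by blast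
  qed
qed

text \<open>The exponents \<open>a\<close> and \<open>b\<close> count the halvings of each side;
  their sum measures the progress of the loop.\<close>

definition boxed :: "nat \<Rightarrow> (nat \<Rightarrow> real) \<Rightarrow> nat \<Rightarrow> nat \<Rightarrow> (nat \<Rightarrow> real) \<Rightarrow> bool" where
  "boxed j z a b r \<longleftrightarrow>
     0 \<le> r (box n j) \<and> r (box n j + 1) \<le> 1 \<and> 0 \<le> r (box n j + 2) \<and> r (box n j + 3) \<le> 1 \<and>
     r (box n j + 1) - r (box n j) = (1 / 2) ^ a \<and> r (box n j + 3) - r (box n j + 2) = (1 / 2) ^ b \<and>
     planar_relation.trapping (2 * err j) (slice j z)
       (r (box n j)) (r (box n j + 1)) (r (box n j + 2)) (r (box n j + 3))"

definition queried :: "nat \<Rightarrow> store \<Rightarrow> store \<Rightarrow> bool" where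
  "queried j s0 s \<longleftrightarrow> frame (Suc j) s0 s \<and> evaluated s \<and> residual k f j (rmem s) \<le> err j \<and>
     rmem s (2 * j) = (rmem s (box n j) + rmem s (box n j + 1)) / 2 \<and>
     rmem s (2 * j + 1) = (rmem s (box n j + 2) + rmem s (box n j + 3)) / 2"

lemma boxed_order:
  assumes "boxed j z a b r"
  shows "r (box n j) \<le> r (box n j + 1)" "r (box n j + 2) \<le> r (box n j + 3)"
proof -
  have "(0::real) \<le> (1 / 2) ^ a" "(0::real) \<le> (1 / 2) ^ b" by simp_all
  then show "r (box n j) \<le> r (box n j + 1)" "r (box n j + 2) \<le> r (box n j + 3)"
    using assms unfolding boxed_def by linarith+
qed

text \<open>The centre of a box inside the unit square provides the two coordinates that
  \<open>ready j\<close> requires beyond \<open>ready (Suc j)\<close>. The lower search changes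
  neither them nor the box.\<close>

lemma query_centre:
  assumes IH: "solves j T" and j: "j < n" and r0: "ready (Suc j) s0"
    and fr: "frame (Suc j) s0 s" and bx: "boxed j z a b (rmem s)"
  shows "\<exists>s'. halts_within k f (Seq (centre n j) (search n j)) (18 + T) s s' \<and>
    queried j s0 s' \<and> boxed j z a b (rmem s')"
proof -
  obtain s1 where h1: "halts_within k f (centre n j) 18 s s1"
    and m1: "rmem s1 = (rmem s)(2 * j := (rmem s (box n j) + rmem s (box n j + 1)) / 2,
      2 * j + 1 := (rmem s (box n j + 2) + rmem s (box n j + 3)) / 2)"
    using halts_within_centre[OF j] by blast
  have f1: "frame (Suc j) s s1" using j by (auto simp: frame_def m1 box_def)
  have rs1: "ready (Suc j) s1" using r0 fr f1 ready_frame frame_trans by blast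
  have "ready j s1"
    unfolding ready_def
  proof (intro conjI allI impI)
    show "rmem s1 (4 * n) = \<epsilon>" using rs1 by (simp add: ready_def)
    fix i assume i: "2 * n + k \<le> i \<and> i < 4 * n"
    then show "rmem s1 i = 0" using rs1 by (simp add: ready_def)
  next
    fix i assume i: "2 * j \<le> i \<and> i < 2 * n"
    consider "i = 2 * j" | "i = 2 * j + 1" | "2 * Suc j \<le> i" using i by fastforce
    then have "0 \<le> rmem s1 i \<and> rmem s1 i \<le> 1"
    proof cases
      case 1
      then show ?thesis using bx boxed_order[OF bx] by (auto simp: m1 boxed_def)
    next
      case 2
      then show ?thesis using bx boxed_order[OF bx] by (auto simp: m1 boxed_def)
    next
      case 3
      then show ?thesis using rs1 i by (simp add: ready_def)
    qed
    then show "0 \<le> rmem s1 i" "rmem s1 i \<le> 1" by auto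
  qed
  then obtain s2 where h2: "halts_within k f (search n j) T s1 s2" and f2: "frame j s1 s2"
    and e2: "evaluated s2" "residual k f j (rmem s2) \<le> err j"
    using IH unfolding solves_def by blast
  have keep: "rmem s2 (2 * j) = rmem s1 (2 * j)" "rmem s2 (2 * j + 1) = rmem s1 (2 * j + 1)"
    using f2 j by (auto simp: frame_def)
  have bk: "rmem s2 (box n j + i) = rmem s (box n j + i)" for i
    using f2 j by (auto simp: frame_def m1 box_def)
  note bk' = bk[of 0, simplified] bk[of 1] bk[of 2] bk[of 3]
  have "frame (Suc j) s0 s2"
    using fr f1 frame_mono[OF f2, of "Suc j"] frame_trans by (meson le_Suc_eq order_refl)
  then have "queried j s0 s2"
    unfolding queried_def bk' keep using e2 by (simp add: m1)
  moreover have "boxed j z a b (rmem s2)" using bx unfolding boxed_def bk' .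
  ultimately show ?thesis using halts_within_Seq[OF h1 h2] by blast
qed

lemma queried_slice:
  assumes "queried j s0 s" "j < n"
  shows "slice j (rmem s0) (rmem s (2 * j)) (rmem s (2 * j + 1))
    (rmem s (2 * n + 2 * j)) (rmem s (2 * n + (2 * j + 1)))"
proof -
  have "\<forall>i<2 * n. rmem s (2 * n + i) = g (rmem s) i"
    using assms(1) by (simp add: queried_def evaluated_def)
  then have "rmem s (2 * n + 2 * j) = g (rmem s) (2 * j)"
    "rmem s (2 * n + (2 * j + 1)) = g (rmem s) (2 * j + 1)"
    using assms(2) by (simp_all del: add_Suc_right One_nat_def)
  then show ?thesis
    unfolding slice_def using assms(1)
    \<comment> \<open>The memory itself is the witness; \<open>frame (Suc j)\<close> makes its
      higher coordinates those of \<open>s0\<close>.\<close>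
    by (intro exI[of _ "rmem s"]) (simp add: queried_def evaluated_def frame_def)
qed

lemma queried_eps: "queried j s0 s \<Longrightarrow> ready (Suc j) s0 \<Longrightarrow> rmem s (4 * n) = \<epsilon>"
  using ready_frame[of "Suc j" s0 s] by (simp add: queried_def ready_def)

text \<open>Only a side longer than \<open>2 * err j\<close> is cut. Such a side has exponent below
  \<open>M\<close>, so both exponents stay at most \<open>M\<close> while their sum grows by
  one.\<close>

lemma boxed_cut:
  assumes j: "j < n" and r0: "ready (Suc j) s0" and q: "queried j s0 s"
    and bx: "boxed j (rmem s0) a b (rmem s)"
    and far: "\<not> bval (near n j) s" and M: "(1 / 2) ^ M \<le> 2 * err j" and ab: "a \<le> M" "b \<le> M"
  shows "\<exists>s' a' b'. halts_within k f (cut n j) 60 s s' \<and> frame (Suc j) s0 s' \<and>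
    boxed j (rmem s0) a' b' (rmem s') \<and> a' \<le> M \<and> b' \<le> M \<and> a' + b' = Suc (a + b)"
proof -
  interpret planar_relation "2 * err j" "slice j (rmem s0)" using planar_relation_slice[OF j] .
  define w where "w = 2 * err j"
  define x0 where "x0 = rmem s (box n j)"
  define x1 where "x1 = rmem s (box n j + 1)"
  define y0 where "y0 = rmem s (box n j + 2)"
  define y1 where "y1 = rmem s (box n j + 3)"
  define x where "x = rmem s (2 * j)"
  define y where "y = rmem s (2 * j + 1)"
  define u where "u = rmem s (2 * n + 2 * j)"
  define v where "v = rmem s (2 * n + (2 * j + 1))"
  note folds = x0_def[symmetric] x1_def[symmetric] y0_def[symmetric] y1_def[symmetric]
    x_def[symmetric] y_def[symmetric] u_def[symmetric] v_def[symmetric] w_def[symmetric]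
  have eps: "rmem s (4 * n) = \<epsilon>"
    using queried_eps[OF q r0] .
  have dxy: "rval (dx n j) s = u - x" "rval (dy n j) s = v - y"
    by (simp_all only: dx_def dy_def rval.simps rval_cell folds)
  have S: "slice j (rmem s0) x y u v" using queried_slice[OF q j] by (simp only: folds)
  have mid: "x = (x0 + x1) / 2" "y = (y0 + y1) / 2"
    using q by (simp_all only: queried_def folds)
  have t: "trapping x0 x1 y0 y1" and bounds: "0 \<le> x0" "x1 \<le> 1" "0 \<le> y0" "y1 \<le> 1"
    and wd: "x1 - x0 = (1 / 2) ^ a" "y1 - y0 = (1 / 2) ^ b"
    using bx by (simp_all only: boxed_def folds)
  have ord: "x0 \<le> x1" "y0 \<le> y1"
    using boxed_order[OF bx] by (simp_all only: folds)
  then have inbox: "x0 \<le> x" "x \<le> x1" "y0 \<le> y" "y \<le> y1" by (auto simp: mid)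
  have far': "\<not> (\<bar>(u - x) + (v - y)\<bar> \<le> 8 * w \<and> \<bar>(u - x) - (v - y)\<bar> \<le> 8 * w)"
    using far unfolding bval_near[OF eps] dxy folds .
  note tc = trapping_cut[OF t S inbox far'[unfolded w_def], folded w_def]
  \<comment> \<open>If both sides were short, the trapping property would make the centre pass the
    test \<open>near\<close>.\<close>
  have wide: "w < x1 - x0 \<or> w < y1 - y0"
    using trapping_small_box[OF t _ _ S inbox] far' unfolding folds by (meson not_less)
  have aM: "a < M" if "w < x1 - x0"
    using that ab M wd unfolding folds by (metis leD le_neq_implies_less)
  have bM: "b < M" if "w < y1 - y0"
    using that ab M wd unfolding folds by (metis leD le_neq_implies_less)
  define C where "C \<longleftrightarrow> w < x1 - x0 \<and>
      (y1 - y0 \<le> w \<or> 0 \<le> ((u - x) + (v - y)) * ((u - x) - (v - y)))"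
  obtain s' where h: "halts_within k f (cut n j) 60 s s'"
    and m: "rmem s' = (if C
      then (rmem s)((if x < u then box n j else box n j + 1) := x)
      else (rmem s)((if y < v then box n j + 2 else box n j + 3) := y))"
    using halts_within_cut[OF eps, of j] unfolding dxy folds C_def by blast
  have fr: "frame (Suc j) s0 s'"
    using q j unfolding queried_def frame_def m box_def by auto
  have half: "x1 - x = (1 / 2) ^ Suc a" "x - x0 = (1 / 2) ^ Suc a"
     "y1 - y = (1 / 2) ^ Suc b" "y - y0 = (1 / 2) ^ Suc b"
    unfolding power_Suc mid wd[symmetric] by (simp_all add: field_simps)
  show ?thesis
  proof (cases C)
    case True
    have "boxed j (rmem s0) (Suc a) b (rmem s')"
    proof (cases "x < u")
      case True
      have regs: "rmem s' (box n j) = x" "rmem s' (box n j + 1) = x1"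
        "rmem s' (box n j + 2) = y0" "rmem s' (box n j + 3) = y1"
        using True \<open>C\<close> by (simp_all add: m x0_def x1_def y0_def y1_def)
      have "trapping x x1 y0 y1" using tc(1)[OF \<open>C\<close>[unfolded C_def]] True unfolding w_def by blast
      then show ?thesis unfolding boxed_def regs using bounds inbox wd half by simp
    next
      case False
      have regs: "rmem s' (box n j) = x0" "rmem s' (box n j + 1) = x"
        "rmem s' (box n j + 2) = y0" "rmem s' (box n j + 3) = y1"
        using False \<open>C\<close> by (simp_all add: m x0_def x1_def y0_def y1_def)
      have "trapping x0 x y0 y1" using tc(2)[OF \<open>C\<close>[unfolded C_def]] False unfolding w_def by blast
      then show ?thesis unfolding boxed_def regs using bounds inbox wd half by simp
    qed
    then show ?thesis using h fr ab aM True unfolding C_def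
      by (intro exI[of _ s'] exI[of _ "Suc a"] exI[of _ b]) auto
  next
    case False
    have bM': "b < M" using bM wide False unfolding C_def by force
    have "boxed j (rmem s0) a (Suc b) (rmem s')"
    proof (cases "y < v")
      case True
      have regs: "rmem s' (box n j) = x0" "rmem s' (box n j + 1) = x1"
        "rmem s' (box n j + 2) = y" "rmem s' (box n j + 3) = y1"
        using True \<open>\<not> C\<close> by (simp_all add: m x0_def x1_def y0_def y1_def)
      have "trapping x0 x1 y y1" using tc(3)[OF \<open>\<not> C\<close>[unfolded C_def] wide] True unfolding w_def by blast
      then show ?thesis unfolding boxed_def regs using bounds inbox wd half by simp
    next
      case False
      have regs: "rmem s' (box n j) = x0" "rmem s' (box n j + 1) = x1"
        "rmem s' (box n j + 2) = y0" "rmem s' (box n j + 3) = y"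
        using False \<open>\<not> C\<close> by (simp_all add: m x0_def x1_def y0_def y1_def)
      have "trapping x0 x1 y0 y" using tc(4)[OF \<open>\<not> C\<close>[unfolded C_def] wide] False unfolding w_def by blast
      then show ?thesis unfolding boxed_def regs using bounds inbox wd half by simp
    qed
    then show ?thesis using h fr ab bM'
      by (intro exI[of _ s'] exI[of _ a] exI[of _ "Suc b"]) auto
  qed
qed

lemma bcost_near: "bcost (near n j) = 83"
  by (simp add: near_def abs_le_def slack_def dx_def dy_def)

text \<open>Since \<open>\<bar>a\<bar> + \<bar>b\<bar>\<close> is the maximum of
  \<open>\<bar>a + b\<bar>\<close> and \<open>\<bar>a - b\<bar>\<close>, the test bounds the
  contribution of the pair by \<open>16 * err j\<close>.\<close>

lemma near_residual:
  assumes q: "queried j s0 s" and r0: "ready (Suc j) s0" and j: "j < n" and "bval (near n j) s"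
  shows "residual k f (Suc j) (rmem s) \<le> err (Suc j)"
proof -
  have eps: "rmem s (4 * n) = \<epsilon>"
    using queried_eps[OF q r0] .
  have val: "rval (dx n j) s = g (rmem s) (2 * j) - rmem s (2 * j)"
    "rval (dy n j) s = g (rmem s) (2 * j + 1) - rmem s (2 * j + 1)"
    using q j by (simp_all add: dx_def dy_def queried_def evaluated_def del: add_Suc_right)
  have "residual k f (Suc j) (rmem s) =
      residual k f j (rmem s) + \<bar>rval (dx n j) s\<bar> + \<bar>rval (dy n j) s\<bar>"
    unfolding val by (simp add: residual_def)
  also have "\<dots> \<le> err j + 8 * (2 * err j)"
    using q assms(4) unfolding bval_near[OF eps] queried_def by linarith
  finally show ?thesis by (simp add: mult.left_commute)
qed

text \<open>\<open>N\<close> is the number of cuts still possible. A round costs 85 for the test, 60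
  for the cut and \<open>18 + T\<close> for the next evaluation; the remaining 85 pays for the final
  test.\<close>

lemma halts_within_loop:
  assumes IH: "solves j T" and j: "j < n" and r0: "ready (Suc j) s0"
    and M: "(1 / 2) ^ M \<le> 2 * err j"
  shows "queried j s0 s \<Longrightarrow> boxed j (rmem s0) a b (rmem s) \<Longrightarrow> a \<le> M \<Longrightarrow> b \<le> M \<Longrightarrow>
    2 * M = a + b + N \<Longrightarrow>
    \<exists>s'. halts_within k f (While (Neg (near n j)) (Seq (cut n j) (Seq (centre n j) (search n j))))
        (85 + N * (163 + T)) s s' \<and> queried j s0 s' \<and> bval (near n j) s'"
proof (induction N arbitrary: s a b)
  case N: 0
  have "bval (near n j) s"
    \<comment> \<open>With \<open>a + b = 2 * M\<close>, a further cut would push one exponent above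
      \<open>M\<close>.\<close>
    using boxed_cut[OF j r0 N(1,2) _ M N(3,4)] N(3-5) by fastforce
  then have "halts_within k f (While (Neg (near n j)) (Seq (cut n j) (Seq (centre n j) (search n j))))
        85 s s"
    using halts_within_WhileFalse[of "Neg (near n j)" s k f] by (simp add: bcost_near)
  then show ?case using N(1) \<open>bval (near n j) s\<close> by auto
next
  case (Suc N)
  show ?case
  proof (cases "bval (near n j) s")
    case True
    then have "halts_within k f (While (Neg (near n j)) (Seq (cut n j) (Seq (centre n j) (search n j))))
        85 s s"
      using halts_within_WhileFalse[of "Neg (near n j)" s k f] by (simp add: bcost_near)
    then have "halts_within k f (While (Neg (near n j)) (Seq (cut n j) (Seq (centre n j) (search n j))))
        (85 + Suc N * (163 + T)) s s" by (rule halts_within_mono) simp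
    then show ?thesis using Suc.prems(1) True by blast
  next
    case False
    obtain s1 a' b' where s1: "halts_within k f (cut n j) 60 s s1" "frame (Suc j) s0 s1"
      "boxed j (rmem s0) a' b' (rmem s1)" "a' \<le> M" "b' \<le> M" "a' + b' = Suc (a + b)"
      using boxed_cut[OF j r0 Suc.prems(1,2) False M Suc.prems(3,4)] by blast
    obtain s2 where s2: "halts_within k f (Seq (centre n j) (search n j)) (18 + T) s1 s2"
      "queried j s0 s2" "boxed j (rmem s0) a' b' (rmem s2)"
      using query_centre[OF IH j r0 s1(2,3)] by blast
    obtain s3 where s3: "halts_within k f
        (While (Neg (near n j)) (Seq (cut n j) (Seq (centre n j) (search n j)))) (85 + N * (163 + T)) s2 s3"
      "queried j s0 s3" "bval (near n j) s3"
      using Suc.IH[OF s2(2,3) s1(4,5)] s1(6) Suc.prems(5) by auto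
    have "halts_within k f
        (While (Neg (near n j)) (Seq (cut n j) (Seq (centre n j) (search n j))))
        (1 + bcost (Neg (near n j)) + (60 + (18 + T)) + (85 + N * (163 + T))) s s3"
      by (rule halts_within_WhileTrue[OF _ halts_within_Seq[OF s1(1) s2(1)] s3(1)]) (use False in simp)
    then have "halts_within k f
        (While (Neg (near n j)) (Seq (cut n j) (Seq (centre n j) (search n j))))
        (85 + Suc N * (163 + T)) s s3"
      by (rule halts_within_mono) (simp add: bcost_near)
    then show ?thesis using s3 by blast
  qed
qed

lemma solves_Suc:
  assumes IH: "solves j T" and j: "j < n" and M: "(1 / 2) ^ M \<le> 2 * err j"
  shows "solves (Suc j) ((2 * M + 2) * (T + 163))"
  unfolding solves_def
proof (intro allI impI)
  fix s0 assume r0: "ready (Suc j) s0"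
  interpret planar_relation "2 * err j" "slice j (rmem s0)" using planar_relation_slice[OF j] .
  obtain s1 where h1: "halts_within k f (reset_box n j) 12 s0 s1" and
    m1: "rmem s1 = (rmem s0)(box n j := 0, box n j + 1 := 1, box n j + 2 := 0, box n j + 3 := 1)"
    using halts_within_reset_box by blast
  have f1: "frame (Suc j) s0 s1" using j by (auto simp: frame_def m1 box_def)
  have b1: "boxed j (rmem s0) 0 0 (rmem s1)"
    using trapping_unit by (simp add: boxed_def m1)
  obtain s2 where s2: "halts_within k f (Seq (centre n j) (search n j)) (18 + T) s1 s2"
    "queried j s0 s2" "boxed j (rmem s0) 0 0 (rmem s2)"
    using query_centre[OF IH j r0 f1 b1] by blast
  obtain s3 where s3: "halts_within k f
      (While (Neg (near n j)) (Seq (cut n j) (Seq (centre n j) (search n j))))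
      (85 + 2 * M * (163 + T)) s2 s3" "queried j s0 s3" "bval (near n j) s3"
    using halts_within_loop[OF IH j r0 M s2(2,3), of "2 * M"] by auto
  have "halts_within k f (search n (Suc j)) (12 + ((18 + T) + (85 + 2 * M * (163 + T)))) s0 s3"
    unfolding search.simps by (rule halts_within_Seq[OF h1 halts_within_Seq[OF s2(1) s3(1)]])
  then have "halts_within k f (search n (Suc j)) ((2 * M + 2) * (T + 163)) s0 s3"
    by (rule halts_within_mono) (simp add: algebra_simps)
  then show "\<exists>s'. halts_within k f (search n (Suc j)) ((2 * M + 2) * (T + 163)) s0 s' \<and>
      frame (Suc j) s0 s' \<and> evaluated s' \<and> residual k f (Suc j) (rmem s') \<le> err (Suc j)"
    using s3(2) near_residual[OF s3(2) r0 j s3(3)] unfolding queried_def by blast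
qed

text \<open>The offset 326 turns the recurrence of \<open>solves_Suc\<close> into a purely
  multiplicative one: the factor \<open>2 * M + 2\<close> is at least 2, so its product with 163
  covers 326. At level 0 the bound is \<open>3 + 326 = 329\<close>.\<close>

lemma solves_within:
  assumes M: "(1 / 2) ^ M \<le> \<epsilon> / 17 ^ n"
  shows "j \<le> n \<Longrightarrow> \<exists>T. T + 326 \<le> (2 * M + 2) ^ j * 329 \<and> solves j T"
proof (induction j)
  case 0
  then show ?case using solves_0 by (intro exI[of _ 3]) simp
next
  case (Suc j)
  then obtain T where T: "T + 326 \<le> (2 * M + 2) ^ j * 329" "solves j T" by auto
  \<comment> \<open>One \<open>M\<close> serves all levels, since the slack is smallest at level
    0.\<close>
  have "\<epsilon> / 17 ^ n * 1 \<le> \<epsilon> / 17 ^ n * (2 * 17 ^ j)"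
  proof (rule mult_left_mono)
    show "1 \<le> 2 * (17::real) ^ j" using one_le_power[of "17::real" j] by linarith
  qed (use eps_pos in simp)
  also have "\<epsilon> / 17 ^ n * (2 * 17 ^ j) = 2 * err j" by simp
  finally have "(1 / 2) ^ M \<le> 2 * err j" using M by simp
  from solves_Suc[OF T(2) _ this] Suc.prems
  have "solves (Suc j) ((2 * M + 2) * (T + 163))" by simp
  moreover have "(2 * M + 2) * (T + 163) + 326 \<le> (2 * M + 2) * (T + 326)"
    by (simp add: algebra_simps)
  then have "(2 * M + 2) * (T + 163) + 326 \<le> (2 * M + 2) * ((2 * M + 2) ^ j * 329)"
    using T(1) by (meson mult_le_mono2 order_trans)
  ultimately show ?case by (intro exI[of _ "(2 * M + 2) * (T + 163)"]) (simp add: mult.assoc)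
qed

end

section \<open>The solver\<close>

text \<open>The input cell of \<open>\<epsilon>\<close> is also the first coordinate of the current
  point, so \<open>\<epsilon>\<close> is moved away before the search.\<close>

definition solver :: "nat \<Rightarrow> com" where
  "solver n = Seq (put (4 * n) (cell 0)) (search n n)"

lemma nat_ceiling_half: "nat \<lceil>real k / 2\<rceil> = (k + 1) div 2"
  by linarith

lemma l1_residual:
  assumes "nonexpansive_l1 k f" "k \<le> 2 * n" "in_cube n p"
  shows "l1_norm (f (vec k p) - vec k p) \<le> residual k f n p"
proof -
  have "vec k p \<in> unit_cube k" using assms(2,3) by (auto simp: in_cube_def unit_cube_def)
  then have "l1_norm (f (vec k p) - vec k p) = (\<Sum>i<k. \<bar>padded k f p i - p i\<bar>)"
    using assms(1) by (auto simp: l1_norm_def padded_def nonexpansive_l1_def unit_cube_def)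
  also have "\<dots> \<le> residual k f n p"
    unfolding residual_def by (rule sum_mono2) (use assms(2) in auto)
  finally show ?thesis .
qed

section \<open>The number of halvings and the asymptotic bound\<close>

definition halvings :: "nat \<Rightarrow> real \<Rightarrow> nat" where
  "halvings n \<epsilon> = nat \<lceil>log 2 (17 ^ n / \<epsilon>)\<rceil>"

lemma halvings_le:
  assumes "0 < \<epsilon>"
  shows "(1 / 2) ^ halvings n \<epsilon> \<le> \<epsilon> / 17 ^ n"
proof -
  have "17 ^ n / \<epsilon> = 2 powr log 2 (17 ^ n / \<epsilon>)" using assms by simp
  also have "\<dots> \<le> 2 powr real (halvings n \<epsilon>)"
    unfolding halvings_def by (intro powr_mono) linarith+
  also have "\<dots> = 2 ^ halvings n \<epsilon>" by (simp add: powr_realpow)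
  finally show ?thesis using assms by (simp add: field_simps power_one_over)
qed

definition time_bound :: "nat \<Rightarrow> real \<Rightarrow> nat" where
  "time_bound n \<epsilon> = (2 * halvings n \<epsilon> + 2) ^ n * 329"

lemma solver_correct:
  assumes k: "k \<le> 2 * n"
  shows "solves_NonExp1_in_time (solver n) k (time_bound n)"
  unfolding solves_NonExp1_in_time_def
proof (intro allI impI)
  fix \<epsilon> f assume a: "0 < \<epsilon> \<and> \<epsilon> \<le> (1::real) \<and> nonexpansive_l1 k f"
  interpret nonexpansive_oracle k f n \<epsilon> using a k by unfold_locales auto
  define s0 where "s0 = input_store \<epsilon> k"
  define s1 where "s1 = s0\<lparr>rmem := (rmem s0)(4 * n := rval (cell 0) s0)\<rparr>"
  show "\<exists>t s. exec k f (solver n) (input_store \<epsilon> k) t s \<and> t \<le> time_bound n \<epsilon> \<and>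
           eps_fixed_point k f \<epsilon> (output_point k s)"
  proof -
    have h1: "halts_within k f (put (4 * n) (cell 0)) 4 s0 s1"
      using halts_within_put[of k f "4 * n" "cell 0" s0] by (simp add: s1_def)
    have "ready n s1" by (auto simp: ready_def s1_def s0_def input_store_def)
    moreover obtain T where T: "T + 326 \<le> (2 * halvings n \<epsilon> + 2) ^ n * 329" "solves n T"
      using solves_within[OF halvings_le, of n] a by blast
    ultimately obtain s2 where h2: "halts_within k f (search n n) T s1 s2" and
      e: "evaluated s2" and r: "residual k f n (rmem s2) \<le> \<epsilon>"
      unfolding solves_def by auto
    obtain t where "exec k f (solver n) s0 t s2" "t \<le> 4 + T"
      using halts_within_Seq[OF h1 h2] unfolding solver_def halts_within_def by blast
    \<comment> \<open>The offset 326 also absorbs the four steps that copy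
      \<open>\<epsilon>\<close>.\<close>
    moreover have "4 + T \<le> time_bound n \<epsilon>" using T(1) by (simp add: time_bound_def)
    moreover have c: "in_cube n (rmem s2)" using e by (simp add: evaluated_def)
    have "output_point k s2 = vec k (rmem s2)" by (simp add: output_point_def read_vec_def)
    then have "eps_fixed_point k f \<epsilon> (output_point k s2)"
      using l1_residual[OF nonexp k c] r vec_in_unit_cube[OF c] by (simp add: eps_fixed_point_def)
    ultimately show ?thesis unfolding s0_def by (meson order_trans)
  qed
qed

text \<open>For \<open>\<epsilon> < exp (- 1)\<close> the logarithm is at least 1, so it absorbs the
  additive terms, including those from \<open>17 ^ n\<close> and from rounding up.\<close>

lemma halvings_bigo: "(\<lambda>\<epsilon>. real (2 * halvings n \<epsilon> + 2)) \<in> O[at_right 0](\<lambda>\<epsilon>. ln (1 / \<epsilon>))"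
proof (rule bigoI)
  have "\<forall>\<^sub>F \<epsilon>::real in at_right 0. \<epsilon> \<in> {0<..<exp (- 1)}"
    by (rule eventually_at_right_real) simp
  then show "\<forall>\<^sub>F \<epsilon> in at_right 0. norm (real (2 * halvings n \<epsilon> + 2)) \<le>
    (2 * real n * log 2 17 + 2 / ln 2 + 4) * norm (ln (1 / \<epsilon>))"
  proof eventually_elim
    case (elim \<epsilon>)
    define L where "L = ln (1 / \<epsilon>)"
    have pos: "0 < \<epsilon>" using elim by simp
    have "ln \<epsilon> < ln (exp (- 1))" using elim by (subst ln_less_cancel_iff) auto
    then have L: "1 \<le> L" using pos by (simp add: L_def ln_div)
    have "log 2 (17 ^ n / \<epsilon>) = real n * log 2 17 + L / ln 2"
      using pos by (simp add: log_divide log_nat_power L_def ln_div) (simp add: log_def)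
    moreover have "0 \<le> real n * log 2 17 + L / ln 2" using L by simp
    ultimately have "real (halvings n \<epsilon>) \<le> real n * log 2 17 + L / ln 2 + 1"
      unfolding halvings_def by linarith
    then have "real (2 * halvings n \<epsilon> + 2) \<le> (2 * real n * log 2 17 + 4) * 1 + 2 / ln 2 * L"
      by simp
    also have "\<dots> \<le> (2 * real n * log 2 17 + 4) * L + 2 / ln 2 * L"
      using L by (intro add_right_mono mult_left_mono) auto
    finally show ?case using L by (simp add: L_def[symmetric] algebra_simps)
  qed
qed

lemma time_bound_bigo:
  "(\<lambda>\<epsilon>. real (time_bound n \<epsilon>)) \<in> O[at_right 0](\<lambda>\<epsilon>. ln (1 / \<epsilon>) ^ n)"
proof -
  have "(\<lambda>\<epsilon>. 329 * real (2 * halvings n \<epsilon> + 2) ^ n) \<in> O[at_right 0](\<lambda>\<epsilon>. ln (1 / \<epsilon>) ^ n)"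
    by (intro landau_o.big.cmult_in_iff[THEN iffD2] landau_o.big_power halvings_bigo) simp
  then show ?thesis by (simp only: time_bound_def of_nat_mult of_nat_power of_nat_numeral mult.commute)
qed

theorem theorem1p2:
  fixes k :: nat
  shows "\<exists>A T. solves_NonExp1_in_time A k T \<and>
    (\<lambda>\<epsilon>::real. real (T \<epsilon>)) \<in> O[at_right 0](\<lambda>\<epsilon>. ln (1 / \<epsilon>) ^ nat \<lceil>real k / 2\<rceil>)"
proof (intro exI conjI)
  \<comment> \<open>This is half of \<open>k\<close> rounded up; for odd \<open>k\<close> one dummy
    coordinate completes the last pair.\<close>
  let ?n = "(k + 1) div 2"
  show "solves_NonExp1_in_time (solver ?n) k (time_bound ?n)"
    by (rule solver_correct) simp
  show "(\<lambda>\<epsilon>. real (time_bound ?n \<epsilon>)) \<in> O[at_right 0](\<lambda>\<epsilon>. ln (1 / \<epsilon>) ^ nat \<lceil>real k / 2\<rceil>)"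
    unfolding nat_ceiling_half by (rule time_bound_bigo)
qed

end
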